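(* Let $(H,\rho)$ be a complete CAT(0) space with the geodesic extension property and let $A:H\rightrightarrows TH$ be a monotone vector field with the surjectivity condition. Then for every $\lambda>0$ and $x\in H$, the $\lambda$-Yosida approximation $A_\lambda$ of $A$ satisfies $$\|A_\lambda x\|\le|Ax|:=\inf_{x^*\in Ax}\|x^*\|,$$ with the convention $\inf\emptyset=+\infty$.
   Context: Geodesics. In a complete CAT(0) space $(H,\rho)$, $\gamma_{x,y}:[0,1]\to H$ denotes the unique geodesic from $x$ to $y$ parametrized with constant speed $\rho(x,y)$; it is called a zero geodesic if $x=y$. For a normalized geodesic $\gamma$ (i.e. parametrized on $[0,1]$ with constant speed), $\zeta(\gamma)=0$ if $\gamma$ is a zero geodesic and $\zeta(\gamma)=1$ otherwise. $H$ has the geodesic extension property if for all $p,q\in H$ there is $\eta:\mathbb{R}\to H$ with $\eta(0)=p$, $\eta(1)=q$ and $\rho(\eta(s),\eta(t))=\rho(p,q)|s-t|$ for all $s,t\in\mathbb{R}$. Tangent spaces. For $q,r\ne p$, the comparison angle $\overline\angle_p(q,r)$ is the angle at $\bar p$ in a Euclidean triangle $\bar p\bar q\bar r$ with the same side lengths as $p,q,r$; set $\overline\angle_p(p,p)=0$ and $\overline\angle_p(p,r)=\overline\angle_p(r,p)=\pi/2$ for $r\neq p$. The Alexandrov angle of geodesics $\gamma_1,\gamma_2$ issuing from $p$ is $\alpha_p(\gamma_1,\gamma_2)=\lim_{s,t\to0^+}\overline\angle_p(\gamma_1(s),\gamma_2(t))$. $S_p$ is the set of normalized geodesics issuing from $p$,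 modulo the relation $\alpha_p=0$, with induced metric $\angle_p$. $T_pH=([0,\infty)\times S_p)/\!\sim$, where $(t_1,\gamma_1)\sim(t_2,\gamma_2)$ iff either $t_1\zeta(\gamma_1)=t_2\zeta(\gamma_2)=0$, or $t_1\zeta(\gamma_1)=t_2\zeta(\gamma_2)>0$ and $\gamma_1=\gamma_2$ in $S_p$. The class of $(t,\gamma)$ is written $t\gamma$, and $\gamma$ stands for $1\gamma$; $s(t\gamma)=(st)\gamma$ for $s\ge0$. Put $\|t\gamma\|=\|t\gamma\|_p=t\zeta(\gamma)$ and $g_p(t_1\gamma_1,t_2\gamma_2)=t_1t_2\zeta(\gamma_1)\zeta(\gamma_2)\cos\angle_p(\gamma_1,\gamma_2)$. $TH=\bigcup_{p\in H}T_pH$. Negative geodesics. For $p,x\in H$, by the geodesic extension property there is $y\in H$ with $\gamma_{x,y}(1/2)=p$; fix one such $y$ for each pair $(p,x)$ and set $-\gamma_{p,x}:=\gamma_{p,y}$. Vector fields. A vector field is a set-valued map $A:H\rightrightarrows TH$ with $Ap\subset T_pH$ for all $p$ (possibly empty). $A$ is monotone if $g_p(\eta,\gamma_{p,q})\le -g_q(\nu,\gamma_{q,p})$ whenever $\eta\in Ap$, $\nu\in Aq$. $A$ satisfies the surjectivity condition if for all $t>0$ and $x\in H$ there is $p\in H$ with $t\rho(p,x)\gamma_{p,x}\in Ap$. For $\lambda>0$, the resolvent is $J_\lambda x=\{z\in H:\lambda^{-1}\rho(z,x)\gamma_{z,x}\in Az\}$, which is a singleton for every $x\in H$ when $A$ is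 monotone with the surjectivity condition, and is then regarded as a map $J_\lambda:H\to H$. The complementary vector field of a map $T:H\to H$ is $A_Tx:=\rho(x,Tx)(-\gamma_{x,Tx})\in T_xH$. The $\lambda$-Yosida approximation of $A$ is $A_\lambda x:=\lambda^{-1}A_{J_\lambda}x$. *)

theory Defs
  imports "HOL-Analysis.Analysis"
begin

text \<open>A metric space is the universe of a type of class \<open>metric_space\<close>; completeness is expressed by
  the class \<open>complete_space\<close>.\<close>


subsection \<open>Geodesics and CAT(0) spaces\<close>

text \<open>Normalized geodesics are maps on \<open>[0,1]\<close>. They are encoded as total functions that are
  \<open>undefined\<close> outside \<open>[0,1]\<close>, so that equality of functions is equality of geodesics.\<close>

type_synonym 'a path = "real \<Rightarrow> 'a"

definition geodesic :: "'a::metric_space path \<Rightarrow> bool" where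
  "geodesic \<gamma> \<longleftrightarrow> \<gamma> \<in> extensional {0..1} \<and>
     (\<forall>s\<in>{0..1}. \<forall>t\<in>{0..1}. dist (\<gamma> s) (\<gamma> t) = dist (\<gamma> 0) (\<gamma> 1) * \<bar>s - t\<bar>)"

definition geodesic_between :: "'a::metric_space \<Rightarrow> 'a \<Rightarrow> 'a path \<Rightarrow> bool" where
  "geodesic_between x y \<gamma> \<longleftrightarrow> geodesic \<gamma> \<and> \<gamma> 0 = x \<and> \<gamma> 1 = y"

text \<open>The CAT(0) inequality. Two points on a common side of a geodesic triangle always have the
  distance of their comparison points, and two different sides share a vertex; hence it is enough
  to compare points on the two sides issuing from a vertex \<open>p\<close>, for all \<open>p\<close>, \<open>q\<close>, \<open>r\<close>.\<close>

definition CAT0 :: "'a::metric_space itself \<Rightarrow> bool" where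
  "CAT0 (_ :: 'a itself) \<longleftrightarrow>
     (\<forall>x y :: 'a. \<exists>\<gamma>. geodesic_between x y \<gamma>) \<and>
     (\<forall>(p :: 'a) q r \<sigma> \<tau>. geodesic_between p q \<sigma> \<longrightarrow> geodesic_between p r \<tau> \<longrightarrow>
        (\<forall>pb qb rb :: real ^ 2.
           dist pb qb = dist p q \<longrightarrow> dist pb rb = dist p r \<longrightarrow> dist qb rb = dist q r \<longrightarrow>
           (\<forall>s\<in>{0..1}. \<forall>t\<in>{0..1}.
              dist (\<sigma> s) (\<tau> t) \<le> dist (pb + s *\<^sub>R (qb - pb)) (pb + t *\<^sub>R (rb - pb)))))"

definition geodesic_extension :: "'a::metric_space itself \<Rightarrow> bool" where
  "geodesic_extension (_ :: 'a itself) \<longleftrightarrow>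
     (\<forall>p q :: 'a. \<exists>\<eta> :: real \<Rightarrow> 'a. \<eta> 0 = p \<and> \<eta> 1 = q \<and>
        (\<forall>s t. dist (\<eta> s) (\<eta> t) = dist p q * \<bar>s - t\<bar>))"

text \<open>The unique geodesic from \<open>x\<close> to \<open>y\<close> in a CAT(0) space.\<close>

definition geod :: "'a::metric_space \<Rightarrow> 'a \<Rightarrow> 'a path" where
  "geod x y = (THE \<gamma>. geodesic_between x y \<gamma>)"

definition zeta :: "'a path \<Rightarrow> real" where
  "zeta \<gamma> = (if \<gamma> 0 = \<gamma> 1 then 0 else 1)"


subsection \<open>Angles\<close>

definition euclidean_angle :: "'b::euclidean_space \<Rightarrow> 'b \<Rightarrow> 'b \<Rightarrow> real" where
  "euclidean_angle p q r = arccos (((q - p) \<bullet> (r - p)) / (norm (q - p) * norm (r - p)))"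

definition comparison_angle :: "'a::metric_space \<Rightarrow> 'a \<Rightarrow> 'a \<Rightarrow> real" where
  "comparison_angle p q r =
     (if q = p \<and> r = p then 0
      else if q = p \<or> r = p then pi / 2
      else (THE \<theta>. \<exists>pb qb rb :: real ^ 2.
              dist pb qb = dist p q \<and> dist pb rb = dist p r \<and> dist qb rb = dist q r \<and>
              \<theta> = euclidean_angle pb qb rb))"

definition alexandrov_angle :: "'a::metric_space \<Rightarrow> 'a path \<Rightarrow> 'a path \<Rightarrow> real" where
  "alexandrov_angle p \<gamma>\<^sub>1 \<gamma>\<^sub>2 =
     Lim (at_right 0 \<times>\<^sub>F at_right 0) (\<lambda>(s, t). comparison_angle p (\<gamma>\<^sub>1 s) (\<gamma>\<^sub>2 t))"


subsection \<open>Tangent spaces\<close>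

text \<open>\<open>S\<^sub>p\<close> and \<open>T\<^sub>pH\<close> are sets of equivalence classes. Functions on classes are defined by means of
  an arbitrary representative.\<close>

type_synonym 'a direction = "'a path set"
type_synonym 'a tangent = "(real \<times> 'a direction) set"

definition rep :: "'b set \<Rightarrow> 'b" where
  "rep C = (SOME z. z \<in> C)"

definition geodesics_from :: "'a::metric_space \<Rightarrow> 'a path set" where
  "geodesics_from p = {\<gamma>. geodesic \<gamma> \<and> \<gamma> 0 = p}"

definition direction_rel :: "'a::metric_space \<Rightarrow> ('a path \<times> 'a path) set" where
  "direction_rel p = {(\<gamma>\<^sub>1, \<gamma>\<^sub>2). \<gamma>\<^sub>1 \<in> geodesics_from p \<and> \<gamma>\<^sub>2 \<in> geodesics_from p \<and>
     alexandrov_angle p \<gamma>\<^sub>1 \<gamma>\<^sub>2 = 0}"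

definition directions :: "'a::metric_space \<Rightarrow> 'a direction set" where
  "directions p = geodesics_from p // direction_rel p"

definition direction_of :: "'a::metric_space \<Rightarrow> 'a path \<Rightarrow> 'a direction" where
  "direction_of p \<gamma> = direction_rel p `` {\<gamma>}"

definition direction_angle :: "'a::metric_space \<Rightarrow> 'a direction \<Rightarrow> 'a direction \<Rightarrow> real" where
  "direction_angle p \<sigma> \<tau> = alexandrov_angle p (rep \<sigma>) (rep \<tau>)"

definition direction_zeta :: "'a direction \<Rightarrow> real" where
  "direction_zeta \<sigma> = zeta (rep \<sigma>)"

definition tangent_rel :: "'a::metric_space \<Rightarrow> ((real \<times> 'a direction) \<times> (real \<times> 'a direction)) set"
  where
  "tangent_rel p = {((t\<^sub>1, \<sigma>\<^sub>1), (t\<^sub>2, \<sigma>\<^sub>2)).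
     (t\<^sub>1, \<sigma>\<^sub>1) \<in> {0..} \<times> directions p \<and> (t\<^sub>2, \<sigma>\<^sub>2) \<in> {0..} \<times> directions p \<and>
     (t\<^sub>1 * direction_zeta \<sigma>\<^sub>1 = 0 \<and> t\<^sub>2 * direction_zeta \<sigma>\<^sub>2 = 0 \<or>
      t\<^sub>1 * direction_zeta \<sigma>\<^sub>1 = t\<^sub>2 * direction_zeta \<sigma>\<^sub>2 \<and> t\<^sub>1 * direction_zeta \<sigma>\<^sub>1 > 0 \<and> \<sigma>\<^sub>1 = \<sigma>\<^sub>2)}"

definition tangent_space :: "'a::metric_space \<Rightarrow> 'a tangent set" where
  "tangent_space p = ({0..} \<times> directions p) // tangent_rel p"

text \<open>\<open>tvec p t \<gamma>\<close> is the tangent vector \<open>t\<gamma> \<in> T\<^sub>pH\<close>, for a geodesic \<open>\<gamma>\<close> issuing from \<open>p\<close>.\<close>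

definition tvec :: "'a::metric_space \<Rightarrow> real \<Rightarrow> 'a path \<Rightarrow> 'a tangent" where
  "tvec p t \<gamma> = tangent_rel p `` {(t, direction_of p \<gamma>)}"

definition tscale :: "'a::metric_space \<Rightarrow> real \<Rightarrow> 'a tangent \<Rightarrow> 'a tangent" where
  "tscale p s v = (case rep v of (t, \<sigma>) \<Rightarrow> tangent_rel p `` {(s * t, \<sigma>)})"

definition tnorm :: "'a tangent \<Rightarrow> real" where
  "tnorm v = (case rep v of (t, \<sigma>) \<Rightarrow> t * direction_zeta \<sigma>)"

definition tinner :: "'a::metric_space \<Rightarrow> 'a tangent \<Rightarrow> 'a tangent \<Rightarrow> real" where
  "tinner p v w = (case rep v of (t\<^sub>1, \<sigma>\<^sub>1) \<Rightarrow> case rep w of (t\<^sub>2, \<sigma>\<^sub>2) \<Rightarrow>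
     t\<^sub>1 * t\<^sub>2 * direction_zeta \<sigma>\<^sub>1 * direction_zeta \<sigma>\<^sub>2 * cos (direction_angle p \<sigma>\<^sub>1 \<sigma>\<^sub>2))"


subsection \<open>Vector fields\<close>

definition vector_field :: "('a::metric_space \<Rightarrow> 'a tangent set) \<Rightarrow> bool" where
  "vector_field A \<longleftrightarrow> (\<forall>p. A p \<subseteq> tangent_space p)"

definition monotone_field :: "('a::metric_space \<Rightarrow> 'a tangent set) \<Rightarrow> bool" where
  "monotone_field A \<longleftrightarrow> (\<forall>p q. \<forall>\<eta>\<in>A p. \<forall>\<nu>\<in>A q.
     tinner p \<eta> (tvec p 1 (geod p q)) \<le> - tinner q \<nu> (tvec q 1 (geod q p)))"

definition surjectivity_condition :: "('a::metric_space \<Rightarrow> 'a tangent set) \<Rightarrow> bool" where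
  "surjectivity_condition A \<longleftrightarrow>
     (\<forall>t>0. \<forall>x. \<exists>p. tvec p (t * dist p x) (geod p x) \<in> A p)"

definition resolvent_set :: "('a::metric_space \<Rightarrow> 'a tangent set) \<Rightarrow> real \<Rightarrow> 'a \<Rightarrow> 'a set" where
  "resolvent_set A l x = {z. tvec z (inverse l * dist z x) (geod z x) \<in> A z}"

definition resolvent :: "('a::metric_space \<Rightarrow> 'a tangent set) \<Rightarrow> real \<Rightarrow> 'a \<Rightarrow> 'a" where
  "resolvent A l x = the_elem (resolvent_set A l x)"

text \<open>A choice of negative geodesics is a function \<open>opp\<close> such that \<open>p\<close> is the midpoint of the
  geodesic from \<open>x\<close> to \<open>opp p x\<close>; the negative of \<open>geod p x\<close> is then \<open>geod p (opp p x)\<close>.\<close>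

definition opposite_choice :: "('a::metric_space \<Rightarrow> 'a \<Rightarrow> 'a) \<Rightarrow> bool" where
  "opposite_choice opp \<longleftrightarrow> (\<forall>p x. geod x (opp p x) (1/2) = p)"

definition neg_geod :: "('a::metric_space \<Rightarrow> 'a \<Rightarrow> 'a) \<Rightarrow> 'a \<Rightarrow> 'a \<Rightarrow> 'a path" where
  "neg_geod opp p x = geod p (opp p x)"

definition complementary_field ::
  "('a::metric_space \<Rightarrow> 'a \<Rightarrow> 'a) \<Rightarrow> ('a \<Rightarrow> 'a) \<Rightarrow> 'a \<Rightarrow> 'a tangent" where
  "complementary_field opp T x = tvec x (dist x (T x)) (neg_geod opp x (T x))"

definition yosida ::
  "('a::metric_space \<Rightarrow> 'a \<Rightarrow> 'a) \<Rightarrow> ('a \<Rightarrow> 'a tangent set) \<Rightarrow> real \<Rightarrow> 'a \<Rightarrow> 'a tangent" where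
  "yosida opp A l x = tscale x (inverse l) (complementary_field opp (resolvent A l) x)"

end

theory Submission
  imports Defs
begin

text \<open>In a CAT(0) space the comparison angle of two geodesics decreases towards the Alexandrov
  angle, so the first variation of the distance gives
  \<open>g\<^sub>p (\<rho>(p,x) \<gamma>\<^sub>p\<^sub>,\<^sub>x, \<gamma>\<^sub>p\<^sub>,\<^sub>q) \<ge> (\<rho>(p,x)\<^sup>2 + \<rho>(p,q)\<^sup>2 - \<rho>(x,q)\<^sup>2) / (2 \<rho>(p,q))\<close>.
  Adding this inequality for \<open>(p,q)\<close> and \<open>(q,p)\<close> and comparing with monotonicity shows that the
  resolvent \<open>J x\<close> is unique. With \<open>z = J x\<close>, monotonicity between \<open>x\<close> and \<open>z\<close> together with the
  case \<open>q = x\<close> yields \<open>-\<parallel>\<eta>\<parallel> \<le> g\<^sub>x (\<eta>, \<gamma>\<^sub>x\<^sub>,\<^sub>z) \<le> -\<rho>(x,z) / \<lambda>\<close> for every \<open>\<eta> \<in> A x\<close>, and the Yosida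
  approximation has norm at most \<open>\<rho>(x,z) / \<lambda>\<close>.\<close>

subsection \<open>Comparison angles\<close>

text \<open>The law of cosines solved for the cosine of the comparison angle. Being an explicit
  expression in distances, it makes monotonicity and limits accessible by algebra, before
  \<open>arccos\<close> is applied.\<close>

definition cos_comparison :: "'a::metric_space \<Rightarrow> 'a \<Rightarrow> 'a \<Rightarrow> real" where
  "cos_comparison p q r =
     ((dist p q)\<^sup>2 + (dist p r)\<^sup>2 - (dist q r)\<^sup>2) / (2 * dist p q * dist p r)"

text \<open>Squaring the triangle inequality gives the lower bound, squaring its reverse form the
  upper one.\<close>

lemma cos_comparison_bounds:
  assumes "q \<noteq> p" "r \<noteq> p"
  shows "-1 \<le> cos_comparison p q r" "cos_comparison p q r \<le> 1"
proof -
  have pos: "dist p q > 0" "dist p r > 0" using assms by auto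
  have "dist q r \<le> dist p q + dist p r" by (metis dist_commute dist_triangle)
  then have "(dist q r)\<^sup>2 \<le> (dist p q + dist p r)\<^sup>2" by (intro power_mono) auto
  then show "-1 \<le> cos_comparison p q r"
    unfolding cos_comparison_def using pos by (simp add: field_simps power2_eq_square)
  have "\<bar>dist p q - dist p r\<bar> \<le> dist q r"
    using dist_triangle[of p q r] dist_triangle[of p r q] by (simp add: dist_commute abs_le_iff)
  then have "(dist p q - dist p r)\<^sup>2 \<le> (dist q r)\<^sup>2" by (metis abs_ge_zero power2_abs power_mono)
  then show "cos_comparison p q r \<le> 1"
    unfolding cos_comparison_def using pos by (simp add: field_simps power2_eq_square)
qed

lemma comparison_triangle:
  fixes p q r :: "'a::metric_space"
  assumes "q \<noteq> p" "r \<noteq> p"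
  obtains pb qb rb :: "real ^ 2"
  where "dist pb qb = dist p q" "dist pb rb = dist p r" "dist qb rb = dist q r"
proof -
  define k where "k = cos_comparison p q r"
  define a where "a = dist p q"
  define b where "b = dist p r"
  \<comment> \<open>\<open>k\<close> and \<open>h\<close> are the cosine and sine of the angle to be
    realized: \<open>p\<close> goes to the origin, \<open>q\<close> to the first axis, and
    \<open>r\<close> to polar coordinates with radius \<open>b\<close>.\<close>
  define h where "h = sqrt (1 - k\<^sup>2)"
  have pos: "a > 0" "b > 0" using assms by (auto simp: a_def b_def)
  have "\<bar>k\<bar> \<le> 1" using cos_comparison_bounds[OF assms] by (simp add: k_def abs_le_iff)
  then have "k\<^sup>2 \<le> 1" by (simp add: abs_square_le_1)
  then have h2: "h\<^sup>2 = 1 - k\<^sup>2" by (simp add: h_def)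
  have c2: "(dist q r)\<^sup>2 = a\<^sup>2 + b\<^sup>2 - 2 * a * b * k"
    unfolding k_def cos_comparison_def using pos
    by (simp add: a_def[symmetric] b_def[symmetric])
  define e f :: "real ^ 2" where "e = axis 1 1" and "f = axis 2 1"
  have ef: "e \<bullet> e = 1" "f \<bullet> f = 1" "e \<bullet> f = 0" "f \<bullet> e = 0"
    by (auto simp: e_def f_def inner_axis_axis)
  define qb where "qb = a *\<^sub>R e"
  define rb where "rb = (b * k) *\<^sub>R e + (b * h) *\<^sub>R f"
  have "norm qb = a" using pos by (simp add: qb_def norm_eq_sqrt_inner ef)
  moreover have "(norm rb)\<^sup>2 = b\<^sup>2 * (k\<^sup>2 + h\<^sup>2)"
    by (simp add: power2_norm_eq_inner rb_def inner_add ef) (simp add: algebra_simps power2_eq_square)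
  then have "(norm rb)\<^sup>2 = b\<^sup>2" by (simp add: h2)
  then have "norm rb = b" using pos by (simp add: power2_eq_iff_nonneg)
  moreover have "(norm (qb - rb))\<^sup>2 = a\<^sup>2 - 2 * a * b * k + b\<^sup>2 * (k\<^sup>2 + h\<^sup>2)"
    by (simp add: power2_norm_eq_inner qb_def rb_def inner_add inner_diff ef)
      (simp add: algebra_simps power2_eq_square)
  then have "(norm (qb - rb))\<^sup>2 = (dist q r)\<^sup>2" by (simp add: h2 c2)
  then have "norm (qb - rb) = dist q r" by (simp add: power2_eq_iff_nonneg)
  ultimately show thesis
    by (intro that[of 0 qb rb]) (auto simp: dist_norm[where 'a="real^2"] a_def b_def)
qed

lemma inner_diff_dist:
  fixes p q r :: "'b::real_inner"
  shows "2 * ((q - p) \<bullet> (r - p)) = (dist p q)\<^sup>2 + (dist p r)\<^sup>2 - (dist q r)\<^sup>2"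
  unfolding dist_norm power2_norm_eq_inner
  by (simp add: inner_diff inner_commute algebra_simps)

text \<open>Polarization expresses the inner product by side lengths. If a leg vanishes, both
  quotients have denominator 0 and therefore value 0.\<close>

lemma euclidean_angle_eq_arccos: "euclidean_angle p q r = arccos (cos_comparison p q r)"
  unfolding euclidean_angle_def cos_comparison_def inner_diff_dist[symmetric]
  by (simp add: dist_norm norm_minus_commute)

text \<open>A comparison triangle exists and its angle depends on the side lengths alone, so the
  definite description in \<open>comparison_angle\<close> denotes.\<close>

lemma comparison_angle_eq_arccos:
  assumes "q \<noteq> p" "r \<noteq> p"
  shows "comparison_angle p q r = arccos (cos_comparison p q r)"
proof -
  obtain pb qb rb :: "real ^ 2"
    where d: "dist pb qb = dist p q" "dist pb rb = dist p r" "dist qb rb = dist q r"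
    using comparison_triangle[OF assms] .
  have eq: "euclidean_angle pb qb rb = arccos (cos_comparison p q r)"
    if "dist pb qb = dist p q" "dist pb rb = dist p r" "dist qb rb = dist q r"
    for pb qb rb :: "real ^ 2"
    unfolding euclidean_angle_eq_arccos using that by (simp add: cos_comparison_def)
  have "(THE \<theta>. \<exists>pb qb rb :: real ^ 2.
          dist pb qb = dist p q \<and> dist pb rb = dist p r \<and> dist qb rb = dist q r \<and>
          \<theta> = euclidean_angle pb qb rb) = arccos (cos_comparison p q r)"
    by (rule the_equality) (use d eq in metis)+
  then show ?thesis using assms by (simp add: comparison_angle_def)
qed

subsection \<open>Geodesics in CAT(0) spaces\<close>

text \<open>Expanding the Euclidean distance between the comparison points and polarizing the inner
  product leaves a CAT(0) inequality in which no comparison point occurs.\<close>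

lemma CAT0_dist_le:
  fixes p q r :: "'a::metric_space"
  assumes "CAT0 TYPE('a)" and "geodesic_between p q \<sigma>" "geodesic_between p r \<tau>"
    and "q \<noteq> p" "r \<noteq> p" and "s \<in> {0..1}" "t \<in> {0..1}"
  shows "(dist (\<sigma> s) (\<tau> t))\<^sup>2 \<le> s\<^sup>2 * (dist p q)\<^sup>2 + t\<^sup>2 * (dist p r)\<^sup>2
           - s * t * ((dist p q)\<^sup>2 + (dist p r)\<^sup>2 - (dist q r)\<^sup>2)"
proof -
  obtain pb qb rb :: "real ^ 2"
    where d: "dist pb qb = dist p q" "dist pb rb = dist p r" "dist qb rb = dist q r"
    using comparison_triangle[OF assms(4,5)] .
  let ?u = "qb - pb" and ?v = "rb - pb"
  have "dist (\<sigma> s) (\<tau> t) \<le> dist (pb + s *\<^sub>R ?u) (pb + t *\<^sub>R ?v)"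
    using assms d unfolding CAT0_def by blast
  then have "(dist (\<sigma> s) (\<tau> t))\<^sup>2 \<le> (dist (pb + s *\<^sub>R ?u) (pb + t *\<^sub>R ?v))\<^sup>2"
    by (intro power_mono) auto
  also have "\<dots> = (norm (s *\<^sub>R ?u - t *\<^sub>R ?v))\<^sup>2"
    by (simp add: dist_norm)
  also have "\<dots> = s\<^sup>2 * (norm ?u)\<^sup>2 + t\<^sup>2 * (norm ?v)\<^sup>2 - s * t * (2 * (?u \<bullet> ?v))"
    unfolding power2_norm_eq_inner
    by (simp only: inner_diff_left inner_diff_right inner_scaleR_left inner_scaleR_right)
      (simp add: inner_commute algebra_simps power2_eq_square)
  also have "norm ?u = dist p q" by (metis d(1) dist_commute dist_norm)
  also have "norm ?v = dist p r" by (metis d(2) dist_commute dist_norm)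
  finally show ?thesis unfolding inner_diff_dist d .
qed

section \<open>Initial segments of geodesics and monotonicity of the comparison cosine\<close>

lemma geodesic_dist:
  assumes "geodesic \<gamma>" "s \<in> {0..1}" "t \<in> {0..1}"
  shows "dist (\<gamma> s) (\<gamma> t) = dist (\<gamma> 0) (\<gamma> 1) * \<bar>s - t\<bar>"
  using assms unfolding geodesic_def by blast

lemma geodesic_dist_start:
  assumes "geodesic \<gamma>" "t \<in> {0..1}"
  shows "dist (\<gamma> 0) (\<gamma> t) = dist (\<gamma> 0) (\<gamma> 1) * t"
  using geodesic_dist[OF assms(1), of 0 t] assms(2) by simp

text \<open>Rescaling to [0,1] makes the CAT(0) inequality applicable to smaller triangles at the
  same vertex; \<open>restrict\<close> supplies the extensionality that \<open>geodesic\<close>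
  demands.\<close>

lemma geodesic_initial_segment:
  assumes "geodesic \<gamma>" "s \<in> {0..1}"
  shows "geodesic_between (\<gamma> 0) (\<gamma> s) (restrict (\<lambda>u. \<gamma> (s * u)) {0..1})"
proof -
  have in01: "s * u \<in> {0..1}" if "u \<in> {0..1}" for u
    using assms(2) that by (auto intro: mult_le_one)
  have "dist (\<gamma> (s * u)) (\<gamma> (s * v)) = dist (\<gamma> 0) (\<gamma> s) * \<bar>u - v\<bar>"
    if "u \<in> {0..1}" "v \<in> {0..1}" for u v
  proof -
    have "\<bar>s * u - s * v\<bar> = s * \<bar>u - v\<bar>"
      using assms(2) by (simp add: right_diff_distrib[symmetric] abs_mult)
    then show ?thesis
      using geodesic_dist[OF assms(1) in01 in01, OF that] geodesic_dist_start[OF assms] by simp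
  qed
  then show ?thesis
    unfolding geodesic_between_def geodesic_def by simp
qed

lemma cos_comparison_mono:
  fixes \<sigma> \<tau> :: "'a::metric_space path"
  assumes cat: "CAT0 TYPE('a)" and g: "geodesic \<sigma>" "geodesic \<tau>" and "\<sigma> 0 = p" "\<tau> 0 = p"
    and ne: "\<sigma> 1 \<noteq> p" "\<tau> 1 \<noteq> p"
    and s: "0 < s'" "s' \<le> s" "s \<le> 1" and t: "0 < t'" "t' \<le> t" "t \<le> 1"
  shows "cos_comparison p (\<sigma> s) (\<tau> t) \<le> cos_comparison p (\<sigma> s') (\<tau> t')"
proof -
  define a where "a = dist p (\<sigma> 1)"
  define b where "b = dist p (\<tau> 1)"
  have pos: "a > 0" "b > 0" using ne by (auto simp: a_def b_def)
  have ds: "dist p (\<sigma> u) = a * u" if "u \<in> {0..1}" for u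
    using geodesic_dist_start[OF g(1) that] assms(4) by (simp add: a_def)
  have dt: "dist p (\<tau> u) = b * u" if "u \<in> {0..1}" for u
    using geodesic_dist_start[OF g(2) that] assms(5) by (simp add: b_def)
  have d1: "dist p (\<sigma> s) = a * s" "dist p (\<sigma> s') = a * s'"
    "dist p (\<tau> t) = b * t" "dist p (\<tau> t') = b * t'"
    using s t by (auto intro: ds dt)
  then have ne': "\<sigma> s \<noteq> p" "\<tau> t \<noteq> p" using pos s t by auto
  \<comment> \<open>CAT(0) is applied to the triangle \<open>p\<close>, \<open>\<sigma> s\<close>,
    \<open>\<tau> t\<close>, in which the inner points have parameters \<open>u\<close> and
    \<open>v\<close>. The factor \<open>u * v\<close> then appears in both numerator and denominator
    of the cosine and cancels.\<close>
  define u where "u = s' / s"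
  define v where "v = t' / t"
  have u: "u \<in> {0..1}" "s' = s * u" "u > 0" and v: "v \<in> {0..1}" "t' = t * v" "v > 0"
    using s t by (auto simp: u_def v_def)
  have seg: "geodesic_between p (\<sigma> s) (restrict (\<lambda>u. \<sigma> (s * u)) {0..1})"
    "geodesic_between p (\<tau> t) (restrict (\<lambda>u. \<tau> (t * u)) {0..1})"
    using geodesic_initial_segment[OF g(1), of s] geodesic_initial_segment[OF g(2), of t]
      assms(4,5) s t by auto
  let ?d = "(a * s)\<^sup>2 + (b * t)\<^sup>2 - (dist (\<sigma> s) (\<tau> t))\<^sup>2"
  have "(dist (\<sigma> s') (\<tau> t'))\<^sup>2 \<le> u\<^sup>2 * (a * s)\<^sup>2 + v\<^sup>2 * (b * t)\<^sup>2 - u * v * ?d"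
    using CAT0_dist_le[OF cat seg ne' u(1) v(1)] u v d1 by simp
  then have le: "u * v * ?d \<le> (a * s')\<^sup>2 + (b * t')\<^sup>2 - (dist (\<sigma> s') (\<tau> t'))\<^sup>2"
    by (simp add: u(2) v(2) power_mult_distrib algebra_simps)
  have "cos_comparison p (\<sigma> s) (\<tau> t) = ?d / (2 * (a * s) * (b * t))"
    by (simp add: cos_comparison_def d1)
  also have "\<dots> = (u * v * ?d) / (2 * (a * s') * (b * t'))"
    using u v pos s t by (simp add: divide_simps)
  also have "\<dots> \<le> cos_comparison p (\<sigma> s') (\<tau> t')"
    unfolding cos_comparison_def d1 using le pos s t
    by (intro divide_right_mono) (auto intro!: mult_nonneg_nonneg)
  finally show ?thesis .
qed

section \<open>Uniqueness of geodesics\<close>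

lemma geodesic_between_unique:
  fixes p q :: "'a::metric_space"
  assumes cat: "CAT0 TYPE('a)" and g: "geodesic_between p q \<sigma>" "geodesic_between p q \<tau>"
  shows "\<sigma> = \<tau>"
proof -
  have "\<sigma> s = \<tau> s" for s
  proof (cases "s \<in> {0..1}")
    case True
    show ?thesis
    proof (cases "q = p")
      case True
      then show ?thesis
        using g \<open>s \<in> {0..1}\<close> geodesic_dist_start[of \<sigma> s] geodesic_dist_start[of \<tau> s]
        by (auto simp: geodesic_between_def)
    next
      case False
      then show ?thesis
        \<comment> \<open>With \<open>r = q\<close> and equal parameters the comparison points
          coincide, and the right-hand side is 0.\<close>
        using CAT0_dist_le[OF cat g False False \<open>s \<in> {0..1}\<close> \<open>s \<in> {0..1}\<close>]
        by (simp add: algebra_simps power2_eq_square mult_le_0_iff)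
    qed
  next
    case False
    then show ?thesis
      using g by (simp add: geodesic_between_def geodesic_def extensional_def)
  qed
  then show ?thesis by blast
qed

lemma geodesic_between_geod:
  fixes x y :: "'a::metric_space"
  assumes cat: "CAT0 TYPE('a)"
  shows "geodesic_between x y (geod x y)"
proof -
  obtain \<gamma> where \<gamma>: "geodesic_between x y \<gamma>" using cat unfolding CAT0_def by blast
  show ?thesis
    unfolding geod_def
    by (rule theI[of "geodesic_between x y", OF \<gamma>]) (rule geodesic_between_unique[OF cat _ \<gamma>])
qed

lemma geod_simps:
  fixes x y :: "'a::metric_space"
  assumes "CAT0 TYPE('a)"
  shows "geod x y \<in> geodesics_from x" "geod x y 0 = x" "geod x y 1 = y"
  using geodesic_between_geod[OF assms, of x y]
  by (auto simp: geodesic_between_def geodesics_from_def)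

subsection \<open>Alexandrov angles\<close>

lemma eventually_at_right_prod:
  assumes "0 < a" "0 < b" and "\<And>s t. 0 < s \<Longrightarrow> s < a \<Longrightarrow> 0 < t \<Longrightarrow> t < b \<Longrightarrow> P s t"
  shows "\<forall>\<^sub>F (s, t) in at_right (0::real) \<times>\<^sub>F at_right (0::real). P s t"
proof -
  have "\<forall>\<^sub>F s in at_right 0. 0 < s \<and> s < a" "\<forall>\<^sub>F t in at_right 0. 0 < t \<and> t < b"
    using assms(1,2) by (auto simp: eventually_at_right)
  then show ?thesis
    by (rule eventually_prodI[THEN eventually_mono]) (use assms(3) in auto)
qed

lemma prod_at_right_neq_bot: "at_right (0::real) \<times>\<^sub>F at_right (0::real) \<noteq> bot"
  by (simp add: prod_filter_eq_bot)

text \<open>Shrinking the parameters increases the comparison cosine, so it converges to its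
  supremum \<open>C\<close> over parameters in (0,1]. Hence the limit defining the angle exists, and
  the value at the endpoints lies below the limit.\<close>

lemma cos_alexandrov_angle:
  fixes \<sigma> \<tau> :: "'a::metric_space path"
  assumes cat: "CAT0 TYPE('a)" and g: "\<sigma> \<in> geodesics_from p" "\<tau> \<in> geodesics_from p"
    and ne: "\<sigma> 1 \<noteq> p" "\<tau> 1 \<noteq> p"
  shows "((\<lambda>(s, t). cos_comparison p (\<sigma> s) (\<tau> t)) \<longlongrightarrow> cos (alexandrov_angle p \<sigma> \<tau>))
           (at_right 0 \<times>\<^sub>F at_right 0)"
    and "cos_comparison p (\<sigma> 1) (\<tau> 1) \<le> cos (alexandrov_angle p \<sigma> \<tau>)"
    and "alexandrov_angle p \<sigma> \<tau> \<in> {0..pi}"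
proof -
  let ?k = "\<lambda>s t. cos_comparison p (\<sigma> s) (\<tau> t)"
  let ?F = "at_right (0::real) \<times>\<^sub>F at_right (0::real)"
  have g': "geodesic \<sigma>" "geodesic \<tau>" "\<sigma> 0 = p" "\<tau> 0 = p"
    using g by (auto simp: geodesics_from_def)
  have nep: "\<sigma> s \<noteq> p \<and> \<tau> s \<noteq> p" if "0 < s" "s \<le> 1" for s
    using geodesic_dist_start[OF g'(1), of s] geodesic_dist_start[OF g'(2), of s] g' ne that
    by auto
  note mono = cos_comparison_mono[OF cat g' ne]
  have bd: "-1 \<le> ?k s t" "?k s t \<le> 1" if "0 < s" "s \<le> 1" "0 < t" "t \<le> 1" for s t
    using cos_comparison_bounds[of "\<sigma> s" p "\<tau> t"] nep[of s] nep[of t] that by auto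
  define X where "X = {?k s t |s t. s \<in> {0<..1} \<and> t \<in> {0<..1}}"
  define C where "C = Sup X"
  have bdd: "bdd_above X"
    by (rule bdd_aboveI[of _ 1]) (use bd in \<open>auto simp: X_def\<close>)
  have upper: "?k s t \<le> C" if "0 < s" "s \<le> 1" "0 < t" "t \<le> 1" for s t
    unfolding C_def by (rule cSup_upper[OF _ bdd]) (use that in \<open>auto simp: X_def\<close>)
  have X11: "?k 1 1 \<in> X"
    unfolding X_def by (rule CollectI, rule exI[of _ 1], rule exI[of _ 1]) auto
  have C1: "C \<le> 1"
    unfolding C_def by (rule cSup_least) (use X11 bd in \<open>auto simp: X_def\<close>)
  have C0: "-1 \<le> C" using upper[of 1 1] bd[of 1 1] by simp
  have lim: "((\<lambda>(s, t). ?k s t) \<longlongrightarrow> C) ?F"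
  proof (rule order_tendstoI)
    fix e assume "e < C"
    \<comment> \<open>A value above \<open>e\<close> is attained at some \<open>(s0, t0)\<close>;
      monotonicity propagates it to all smaller parameters.\<close>
    then obtain x where "x \<in> X" "e < x"
      unfolding C_def using less_cSup_iff[of X e] X11 bdd by blast
    then obtain s0 t0 where st: "0 < s0" "s0 \<le> 1" "0 < t0" "t0 \<le> 1" "e < ?k s0 t0"
      by (auto simp: X_def)
    have "e < ?k s t" if "0 < s" "s < s0" "0 < t" "t < t0" for s t
      using mono[of s s0 t t0] st that by simp
    then have "\<forall>\<^sub>F (s, t) in ?F. e < ?k s t"
      using st by (intro eventually_at_right_prod)
    then show "\<forall>\<^sub>F x in ?F. e < (case x of (s, t) \<Rightarrow> ?k s t)"
      by (simp add: case_prod_unfold)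
  next
    fix e assume "C < e"
    then have "?k s t < e" if "0 < s" "s < 1" "0 < t" "t < 1" for s t
      using upper[of s t] that by simp
    then have "\<forall>\<^sub>F (s, t) in ?F. ?k s t < e"
      by (intro eventually_at_right_prod[of 1 1]) auto
    then show "\<forall>\<^sub>F x in ?F. (case x of (s, t) \<Rightarrow> ?k s t) < e"
      by (simp add: case_prod_unfold)
  qed
  \<comment> \<open>\<open>arccos\<close> is continuous only on [-1,1], so the values have to stay
    eventually in that interval.\<close>
  have range: "\<forall>\<^sub>F x in ?F. (case x of (s, t) \<Rightarrow> ?k s t) \<in> {-1..1}"
    using eventually_at_right_prod[of 1 1 "\<lambda>s t. ?k s t \<in> {-1..1}"] bd
    by (auto simp: case_prod_unfold)
  have "((\<lambda>x. arccos (case x of (s, t) \<Rightarrow> ?k s t)) \<longlongrightarrow> arccos C) ?F"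
    by (rule continuous_on_tendsto_compose[OF continuous_on_arccos' lim _ range])
      (use C0 C1 in auto)
  moreover have "\<forall>\<^sub>F x in ?F. arccos (case x of (s, t) \<Rightarrow> ?k s t)
      = (case x of (s, t) \<Rightarrow> comparison_angle p (\<sigma> s) (\<tau> t))"
    using eventually_at_right_prod[of 1 1
        "\<lambda>s t. arccos (?k s t) = comparison_angle p (\<sigma> s) (\<tau> t)"] nep
    by (auto simp: case_prod_unfold comparison_angle_eq_arccos)
  ultimately have "((\<lambda>(s, t). comparison_angle p (\<sigma> s) (\<tau> t)) \<longlongrightarrow> arccos C) ?F"
    by (rule Lim_transform_eventually)
  then have ang: "alexandrov_angle p \<sigma> \<tau> = arccos C"
    unfolding alexandrov_angle_def by (rule tendsto_Lim[OF prod_at_right_neq_bot])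
  then have cosC: "cos (alexandrov_angle p \<sigma> \<tau>) = C" using C0 C1 by simp
  show "((\<lambda>(s, t). ?k s t) \<longlongrightarrow> cos (alexandrov_angle p \<sigma> \<tau>)) ?F"
    unfolding cosC by (rule lim)
  show "?k 1 1 \<le> cos (alexandrov_angle p \<sigma> \<tau>)" unfolding cosC by (rule upper) auto
  show "alexandrov_angle p \<sigma> \<tau> \<in> {0..pi}"
    unfolding ang using C0 C1 by (auto intro: arccos_lbound arccos_ubound)
qed

text \<open>At equal arc length \<open>r\<close> the law of cosines of the comparison triangle has both legs \<open>r\<close>.\<close>

lemma dist_ratio_tendsto:
  fixes \<sigma> \<tau> :: "'a::metric_space path"
  assumes cat: "CAT0 TYPE('a)" and g: "\<sigma> \<in> geodesics_from p" "\<tau> \<in> geodesics_from p"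
    and ne: "\<sigma> 1 \<noteq> p" "\<tau> 1 \<noteq> p"
  shows "((\<lambda>r. dist (\<sigma> (r / dist p (\<sigma> 1))) (\<tau> (r / dist p (\<tau> 1))) / r)
            \<longlongrightarrow> sqrt (2 - 2 * cos (alexandrov_angle p \<sigma> \<tau>))) (at_right 0)"
proof -
  define a where "a = dist p (\<sigma> 1)"
  define b where "b = dist p (\<tau> 1)"
  have pos: "a > 0" "b > 0" using ne by (auto simp: a_def b_def)
  have g': "geodesic \<sigma>" "geodesic \<tau>" "\<sigma> 0 = p" "\<tau> 0 = p"
    using g by (auto simp: geodesics_from_def)
  \<comment> \<open>Rescaling by positive constants keeps the approach to 0 from the right, so
    \<open>(r / a, r / b)\<close> is a path along which the two-parameter limit may be
    taken.\<close>
  have scale: "filterlim (\<lambda>r. r / c) (at_right 0) (at_right 0)" if "c > 0" for c :: real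
    unfolding filterlim_at
  proof
    have "((\<lambda>r. r / c) \<longlongrightarrow> 0 / c) (at_right 0)" by (intro tendsto_intros) (use that in auto)
    then show "((\<lambda>r. r / c) \<longlongrightarrow> 0) (at_right 0)" by simp
    have "\<forall>\<^sub>F r::real in at_right 0. 0 < r" by (rule eventually_at_right_less)
    then show "\<forall>\<^sub>F x in at_right 0. x / c \<in> {0<..} \<and> x / c \<noteq> 0"
      by eventually_elim (use that in auto)
  qed
  have "((\<lambda>r. case (r / a, r / b) of (s, t) \<Rightarrow> cos_comparison p (\<sigma> s) (\<tau> t))
      \<longlongrightarrow> cos (alexandrov_angle p \<sigma> \<tau>)) (at_right 0)"
    by (rule filterlim_compose[OF cos_alexandrov_angle(1)[OF cat g ne]])
      (intro filterlim_Pair scale pos)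
  then have "((\<lambda>r. sqrt (2 - 2 * cos_comparison p (\<sigma> (r / a)) (\<tau> (r / b))))
      \<longlongrightarrow> sqrt (2 - 2 * cos (alexandrov_angle p \<sigma> \<tau>))) (at_right 0)"
    by (intro tendsto_intros) simp
  moreover have "\<forall>\<^sub>F r in at_right 0. sqrt (2 - 2 * cos_comparison p (\<sigma> (r / a)) (\<tau> (r / b)))
      = dist (\<sigma> (r / a)) (\<tau> (r / b)) / r"
  proof -
    \<comment> \<open>Below \<open>min a b\<close> both parameters stay inside [0,1], where the
      geodesic equation holds.\<close>
    have "\<forall>\<^sub>F r in at_right 0. 0 < r \<and> r < min a b"
      using pos by (auto simp: eventually_at_right intro: exI[of _ "min a b"])
    then show ?thesis
    proof eventually_elim
      case (elim r)
      have "dist p (\<sigma> (r / a)) = r" "dist p (\<tau> (r / b)) = r"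
        using geodesic_dist_start[OF g'(1), of "r / a"] geodesic_dist_start[OF g'(2), of "r / b"]
          elim pos g' by (auto simp: a_def b_def)
      then have "2 - 2 * cos_comparison p (\<sigma> (r / a)) (\<tau> (r / b))
          = (dist (\<sigma> (r / a)) (\<tau> (r / b)) / r)\<^sup>2"
        using elim by (simp add: cos_comparison_def field_simps power2_eq_square)
      then show ?case using elim by simp
    qed
  qed
  ultimately show ?thesis unfolding a_def b_def by (rule Lim_transform_eventually)
qed

text \<open>The distance ratio at equal arc length is symmetric in the two geodesics, and its limit
  determines the angle because \<open>cos\<close> is injective on [0,pi].\<close>

lemma alexandrov_angle_commute:
  fixes \<sigma> \<tau> :: "'a::metric_space path"
  assumes cat: "CAT0 TYPE('a)" and g: "\<sigma> \<in> geodesics_from p" "\<tau> \<in> geodesics_from p"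
    and ne: "\<sigma> 1 \<noteq> p" "\<tau> 1 \<noteq> p"
  shows "alexandrov_angle p \<sigma> \<tau> = alexandrov_angle p \<tau> \<sigma>"
proof -
  have "sqrt (2 - 2 * cos (alexandrov_angle p \<sigma> \<tau>)) = sqrt (2 - 2 * cos (alexandrov_angle p \<tau> \<sigma>))"
    by (rule tendsto_unique[OF trivial_limit_at_right_real dist_ratio_tendsto[OF cat g ne]])
      (subst dist_commute, rule dist_ratio_tendsto[OF cat g(2,1) ne(2,1)])
  then show ?thesis
    using cos_alexandrov_angle(3)[OF cat g ne] cos_alexandrov_angle(3)[OF cat g(2,1) ne(2,1)]
    by (auto intro: cos_inj_pi)
qed

text \<open>By the triangle inequality, the distance ratios to \<open>\<tau>\<close> differ by at
  most the ratio between \<open>\<sigma>\<close> and \<open>\<sigma>'\<close>, which tends to 0.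
  This makes the angle independent of representatives.\<close>

lemma alexandrov_angle_cong_left:
  fixes \<sigma> \<tau> :: "'a::metric_space path"
  assumes cat: "CAT0 TYPE('a)"
    and g: "\<sigma> \<in> geodesics_from p" "\<sigma>' \<in> geodesics_from p" "\<tau> \<in> geodesics_from p"
    and ne: "\<sigma> 1 \<noteq> p" "\<sigma>' 1 \<noteq> p" "\<tau> 1 \<noteq> p"
    and zero: "alexandrov_angle p \<sigma> \<sigma>' = 0"
  shows "alexandrov_angle p \<sigma>' \<tau> = alexandrov_angle p \<sigma> \<tau>"
proof -
  let ?pt = "\<lambda>\<gamma> r. \<gamma> (r / dist p (\<gamma> 1))"
  let ?D = "\<lambda>\<gamma> \<delta> r. dist (?pt \<gamma> r) (?pt \<delta> r) / r"
  let ?c = "\<lambda>\<gamma> \<delta>. sqrt (2 - 2 * cos (alexandrov_angle p \<gamma> \<delta>))"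
  have D0: "(?D \<sigma> \<sigma>' \<longlongrightarrow> 0) (at_right 0)"
    using dist_ratio_tendsto[OF cat g(1,2) ne(1,2)] zero by simp
  have "((\<lambda>r. ?D \<sigma>' \<tau> r - ?D \<sigma> \<tau> r) \<longlongrightarrow> 0) (at_right 0)"
  proof (rule Lim_null_comparison[OF _ D0])
    have "\<forall>\<^sub>F r::real in at_right 0. 0 < r" by (rule eventually_at_right_less)
    then show "\<forall>\<^sub>F r in at_right 0. norm (?D \<sigma>' \<tau> r - ?D \<sigma> \<tau> r) \<le> ?D \<sigma> \<sigma>' r"
    proof eventually_elim
      case (elim r)
      have "\<bar>dist (?pt \<sigma>' r) (?pt \<tau> r) - dist (?pt \<sigma> r) (?pt \<tau> r)\<bar> \<le> dist (?pt \<sigma> r) (?pt \<sigma>' r)"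
        using dist_triangle[of "?pt \<sigma>' r" "?pt \<tau> r" "?pt \<sigma> r"]
          dist_triangle[of "?pt \<sigma> r" "?pt \<tau> r" "?pt \<sigma>' r"]
        by (simp add: dist_commute abs_le_iff)
      then show ?case
        using elim by (simp add: diff_divide_distrib[symmetric] divide_right_mono)
    qed
  qed
  moreover have "((\<lambda>r. ?D \<sigma>' \<tau> r - ?D \<sigma> \<tau> r) \<longlongrightarrow> ?c \<sigma>' \<tau> - ?c \<sigma> \<tau>) (at_right 0)"
    by (intro tendsto_diff dist_ratio_tendsto cat g ne)
  ultimately have "?c \<sigma>' \<tau> - ?c \<sigma> \<tau> = 0"
    using tendsto_unique[OF trivial_limit_at_right_real] by blast
  then show ?thesis
    using cos_alexandrov_angle(3)[OF cat g(1,3) ne(1,3)]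
      cos_alexandrov_angle(3)[OF cat g(2,3) ne(2,3)]
    by (auto intro: cos_inj_pi)
qed

section \<open>Angles given by constant comparison angles\<close>

lemma alexandrov_angle_eqI:
  assumes "\<And>s t. 0 < s \<Longrightarrow> s \<le> 1 \<Longrightarrow> 0 < t \<Longrightarrow> t \<le> 1 \<Longrightarrow> comparison_angle p (\<sigma> s) (\<tau> t) = c"
  shows "alexandrov_angle p \<sigma> \<tau> = c"
  unfolding alexandrov_angle_def
proof (rule tendsto_Lim[OF prod_at_right_neq_bot tendsto_eventually])
  show "\<forall>\<^sub>F x in at_right 0 \<times>\<^sub>F at_right 0. (case x of (s, t) \<Rightarrow> comparison_angle p (\<sigma> s) (\<tau> t)) = c"
    using eventually_at_right_prod[of 1 1 "\<lambda>s t. comparison_angle p (\<sigma> s) (\<tau> t) = c"] assms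
    by (simp add: case_prod_unfold)
qed

lemma geodesic_eq_start_iff:
  assumes "\<gamma> \<in> geodesics_from p" "0 < s" "s \<le> 1"
  shows "\<gamma> s = p \<longleftrightarrow> \<gamma> 1 = p"
  using geodesic_dist_start[of \<gamma> s] assms by (auto simp: geodesics_from_def)

text \<open>Points of one nonzero geodesic span a degenerate comparison triangle with cosine 1; for
  a zero geodesic the convention for two coinciding points gives 0. Every direction class thus
  contains its generator.\<close>

lemma alexandrov_angle_self:
  assumes g: "\<gamma> \<in> geodesics_from p"
  shows "alexandrov_angle p \<gamma> \<gamma> = 0"
proof (rule alexandrov_angle_eqI)
  fix s t :: real assume st: "0 < s" "s \<le> 1" "0 < t" "t \<le> 1"
  show "comparison_angle p (\<gamma> s) (\<gamma> t) = 0"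
  proof (cases "\<gamma> 1 = p")
    case True
    then show ?thesis
      using geodesic_eq_start_iff[OF g st(1,2)] geodesic_eq_start_iff[OF g st(3,4)] by (simp add: comparison_angle_def)
  next
    case False
    have "geodesic \<gamma>" "\<gamma> 0 = p" using g by (auto simp: geodesics_from_def)
    then have "dist p (\<gamma> s) = dist p (\<gamma> 1) * s" "dist p (\<gamma> t) = dist p (\<gamma> 1) * t"
      "dist (\<gamma> s) (\<gamma> t) = dist p (\<gamma> 1) * \<bar>s - t\<bar>"
      using geodesic_dist_start[of \<gamma> s] geodesic_dist_start[of \<gamma> t] geodesic_dist[of \<gamma> s t] st by auto
    then have "cos_comparison p (\<gamma> s) (\<gamma> t) = 1"
      using False st
      by (simp add: cos_comparison_def power_mult_distrib) (simp add: field_simps power2_eq_square)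
    then show ?thesis
      using geodesic_eq_start_iff[OF g st(1,2)] geodesic_eq_start_iff[OF g st(3,4)] False
      by (simp add: comparison_angle_eq_arccos)
  qed
qed

text \<open>The convention \<open>pi / 2\<close> makes the comparison angle constant. It separates
  zero from nonzero geodesics, so \<open>zeta\<close> is constant on directions.\<close>

lemma alexandrov_angle_zero_geodesic:
  assumes g: "\<sigma> \<in> geodesics_from p" "\<tau> \<in> geodesics_from p"
    and "(\<sigma> 1 = p) \<noteq> (\<tau> 1 = p)"
  shows "alexandrov_angle p \<sigma> \<tau> = pi / 2"
proof (rule alexandrov_angle_eqI)
  fix s t :: real assume st: "0 < s" "s \<le> 1" "0 < t" "t \<le> 1"
  show "comparison_angle p (\<sigma> s) (\<tau> t) = pi / 2"
    using geodesic_eq_start_iff[OF g(1) st(1,2)] geodesic_eq_start_iff[OF g(2) st(3,4)] assms(3)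
    by (auto simp: comparison_angle_def)
qed

subsection \<open>Tangent vectors\<close>

lemma zeta_simps:
  assumes "\<gamma> \<in> geodesics_from p"
  shows "zeta \<gamma> = (if \<gamma> 1 = p then 0 else 1)"
  using assms by (auto simp: zeta_def geodesics_from_def)

lemma rep_in: "z \<in> C \<Longrightarrow> rep C \<in> C"
  unfolding rep_def by (rule someI[of "\<lambda>z. z \<in> C"])

lemma rep_direction_of:
  assumes g: "\<gamma> \<in> geodesics_from p"
  shows "rep (direction_of p \<gamma>) \<in> geodesics_from p"
    and "alexandrov_angle p \<gamma> (rep (direction_of p \<gamma>)) = 0"
    and "rep (direction_of p \<gamma>) 1 = p \<longleftrightarrow> \<gamma> 1 = p"
proof -
  have "\<gamma> \<in> direction_of p \<gamma>"
    using g alexandrov_angle_self[OF g] by (simp add: direction_of_def direction_rel_def)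
  then have "rep (direction_of p \<gamma>) \<in> direction_of p \<gamma>"
    by (rule rep_in)
  then show *: "rep (direction_of p \<gamma>) \<in> geodesics_from p"
    "alexandrov_angle p \<gamma> (rep (direction_of p \<gamma>)) = 0"
    by (auto simp: direction_of_def direction_rel_def)
  \<comment> \<open>If only one of the two were a zero geodesic, their angle would be
    \<open>pi / 2\<close> instead of 0.\<close>
  show "rep (direction_of p \<gamma>) 1 = p \<longleftrightarrow> \<gamma> 1 = p"
    using alexandrov_angle_zero_geodesic[OF g *(1)] *(2) by auto
qed

lemma direction_zeta_direction_of:
  assumes "\<gamma> \<in> geodesics_from p"
  shows "direction_zeta (direction_of p \<gamma>) = zeta \<gamma>"
  using rep_direction_of[OF assms] assms by (simp add: direction_zeta_def zeta_simps)

text \<open>Representatives are exchanged one at a time in the left argument, with symmetry moving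
  the other one there and back.\<close>

lemma direction_angle_direction_of:
  fixes \<gamma> \<delta> :: "'a::metric_space path"
  assumes cat: "CAT0 TYPE('a)" and g: "\<gamma> \<in> geodesics_from p" "\<delta> \<in> geodesics_from p"
    and ne: "\<gamma> 1 \<noteq> p" "\<delta> 1 \<noteq> p"
  shows "direction_angle p (direction_of p \<gamma>) (direction_of p \<delta>) = alexandrov_angle p \<gamma> \<delta>"
proof -
  let ?\<gamma> = "rep (direction_of p \<gamma>)" and ?\<delta> = "rep (direction_of p \<delta>)"
  note \<gamma> = rep_direction_of[OF g(1)] and \<delta> = rep_direction_of[OF g(2)]
  have ne': "?\<gamma> 1 \<noteq> p" "?\<delta> 1 \<noteq> p" using \<gamma>(3) \<delta>(3) ne by auto
  have "alexandrov_angle p ?\<gamma> ?\<delta> = alexandrov_angle p \<gamma> ?\<delta>"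
    by (rule alexandrov_angle_cong_left) (use cat g \<gamma> \<delta> ne ne' in auto)
  also have "\<dots> = alexandrov_angle p ?\<delta> \<gamma>"
    by (rule alexandrov_angle_commute) (use cat g \<delta> ne ne' in auto)
  also have "\<dots> = alexandrov_angle p \<delta> \<gamma>"
    by (rule alexandrov_angle_cong_left) (use cat g \<delta> ne ne' in auto)
  also have "\<dots> = alexandrov_angle p \<gamma> \<delta>"
    by (rule alexandrov_angle_commute) (use cat g ne in auto)
  finally show ?thesis by (simp add: direction_angle_def)
qed

text \<open>All zero vectors at \<open>p\<close> form one class, so an arbitrary representative of
  it retains only the vanishing product of scalar and \<open>zeta\<close>. For a nonzero vector both
  the scalar and the direction survive.\<close>

lemma rep_tvec:
  assumes g: "\<gamma> \<in> geodesics_from p" and "t \<ge> 0"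
  obtains t' \<delta> where "rep (tvec p t \<gamma>) = (t', direction_of p \<delta>)" "t' \<ge> 0" "\<delta> \<in> geodesics_from p"
    "t' * zeta \<delta> = t * zeta \<gamma>" "t * zeta \<gamma> \<noteq> 0 \<Longrightarrow> t' = t \<and> direction_of p \<delta> = direction_of p \<gamma>"
proof -
  have dir: "direction_of p \<gamma> \<in> directions p"
    using g by (auto simp: direction_of_def directions_def quotient_def)
  have "(t, direction_of p \<gamma>) \<in> tvec p t \<gamma>"
    using dir assms(2)
    by (auto simp: tvec_def tangent_rel_def direction_zeta_direction_of[OF g] zeta_def)
  then have "rep (tvec p t \<gamma>) \<in> tvec p t \<gamma>"
    by (rule rep_in)
  moreover obtain t' \<sigma> where r: "rep (tvec p t \<gamma>) = (t', \<sigma>)" by (cases "rep (tvec p t \<gamma>)")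
  ultimately have rel: "((t, direction_of p \<gamma>), (t', \<sigma>)) \<in> tangent_rel p"
    by (simp add: tvec_def)
  then have "\<sigma> \<in> directions p" "t' \<ge> 0" by (auto simp: tangent_rel_def)
  then obtain \<delta> where \<delta>: "\<delta> \<in> geodesics_from p" "\<sigma> = direction_of p \<delta>"
    by (auto simp: directions_def quotient_def direction_of_def)
  have eq: "zeta \<delta> = direction_zeta \<sigma>"
    using \<delta> by (simp add: direction_zeta_direction_of)
  show thesis
  proof (rule that[of t' \<delta>])
    show "t' * zeta \<delta> = t * zeta \<gamma>"
      using rel by (auto simp: tangent_rel_def eq direction_zeta_direction_of[OF g])
    show "t' = t \<and> direction_of p \<delta> = direction_of p \<gamma>" if "t * zeta \<gamma> \<noteq> 0"
    proof -
      have \<sigma>: "\<sigma> = direction_of p \<gamma>" "t * zeta \<gamma> = t' * direction_zeta \<sigma>"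
        using rel that by (auto simp: tangent_rel_def direction_zeta_direction_of[OF g])
      have "direction_zeta \<sigma> = zeta \<gamma>"
        using \<sigma>(1) direction_zeta_direction_of[OF g] by simp
      then show ?thesis using \<sigma> \<delta>(2) that by simp
    qed
  qed (use r \<delta> \<open>t' \<ge> 0\<close> in auto)
qed

section \<open>Norm, scaling and inner product on representatives\<close>

lemma tnorm_tvec:
  assumes "\<gamma> \<in> geodesics_from p" "t \<ge> 0"
  shows "tnorm (tvec p t \<gamma>) = t * zeta \<gamma>"
proof -
  obtain t' \<delta> where "rep (tvec p t \<gamma>) = (t', direction_of p \<delta>)"
    "\<delta> \<in> geodesics_from p" "t' * zeta \<delta> = t * zeta \<gamma>"
    using rep_tvec[OF assms] .
  then show ?thesis by (simp add: tnorm_def direction_zeta_direction_of)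
qed

lemma tnorm_tscale_tvec:
  assumes g: "\<gamma> \<in> geodesics_from p" "t \<ge> 0" and "s \<ge> 0"
  shows "tnorm (tscale p s (tvec p t \<gamma>)) = s * t * zeta \<gamma>"
proof -
  obtain t' \<delta> where r: "rep (tvec p t \<gamma>) = (t', direction_of p \<delta>)" "t' \<ge> 0"
    "\<delta> \<in> geodesics_from p" "t' * zeta \<delta> = t * zeta \<gamma>"
    using rep_tvec[OF g] by metis
  have "tscale p s (tvec p t \<gamma>) = tvec p (s * t') \<delta>"
    unfolding tscale_def r(1) by (simp add: tvec_def)
  then show ?thesis
    using tnorm_tvec[OF r(3), of "s * t'"] r assms(3) by simp
qed

lemma tinner_tvec:
  fixes \<gamma> \<delta> :: "'a::metric_space path"
  assumes cat: "CAT0 TYPE('a)" and g: "\<gamma> \<in> geodesics_from p" "\<delta> \<in> geodesics_from p"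
    and "t \<ge> 0" "u \<ge> 0"
  shows "tinner p (tvec p t \<gamma>) (tvec p u \<delta>)
           = t * zeta \<gamma> * (u * zeta \<delta>) * cos (alexandrov_angle p \<gamma> \<delta>)"
proof -
  obtain t' \<gamma>' where 1: "rep (tvec p t \<gamma>) = (t', direction_of p \<gamma>')"
    "\<gamma>' \<in> geodesics_from p" "t' * zeta \<gamma>' = t * zeta \<gamma>"
    "t * zeta \<gamma> \<noteq> 0 \<Longrightarrow> t' = t \<and> direction_of p \<gamma>' = direction_of p \<gamma>"
    using rep_tvec[OF g(1) assms(4)] by metis
  obtain u' \<delta>' where 2: "rep (tvec p u \<delta>) = (u', direction_of p \<delta>')"
    "\<delta>' \<in> geodesics_from p" "u' * zeta \<delta>' = u * zeta \<delta>"
    "u * zeta \<delta> \<noteq> 0 \<Longrightarrow> u' = u \<and> direction_of p \<delta>' = direction_of p \<delta>"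
    using rep_tvec[OF g(2) assms(5)] by metis
  have "tinner p (tvec p t \<gamma>) (tvec p u \<delta>) = (t' * zeta \<gamma>') * (u' * zeta \<delta>') *
      cos (direction_angle p (direction_of p \<gamma>') (direction_of p \<delta>'))"
    by (simp add: tinner_def 1(1,2) 2(1,2) direction_zeta_direction_of)
  also have "\<dots> = (t * zeta \<gamma>) * (u * zeta \<delta>) *
      cos (direction_angle p (direction_of p \<gamma>') (direction_of p \<delta>'))"
    by (simp only: 1(3) 2(3))
  also have "\<dots> = (t * zeta \<gamma>) * (u * zeta \<delta>) * cos (alexandrov_angle p \<gamma> \<delta>)"
  \<comment> \<open>The representatives may have unrelated directions when a vector is zero, but
    then the whole product vanishes.\<close>
  proof (cases "t * zeta \<gamma> = 0 \<or> u * zeta \<delta> = 0")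
    case False
    then have "\<gamma> 1 \<noteq> p" "\<delta> 1 \<noteq> p"
      using g by (auto simp: zeta_simps)
    then show ?thesis
      using False 1(4) 2(4) direction_angle_direction_of[OF cat g] by simp
  qed auto
  finally show ?thesis .
qed

section \<open>Lower bounds for the inner product\<close>

lemma tangent_space_cases:
  assumes "v \<in> tangent_space p"
  obtains t \<gamma> where "t \<ge> 0" "\<gamma> \<in> geodesics_from p" "v = tvec p t \<gamma>"
  using assms
  by (auto simp: tangent_space_def directions_def quotient_def tvec_def direction_of_def)

text \<open>A one-sided Cauchy-Schwarz inequality: \<open>zeta \<delta>\<close> is 0 or 1, so its
  product with a cosine is at least -1.\<close>

lemma tinner_ge_minus_tnorm:
  fixes v :: "'a::metric_space tangent"
  assumes cat: "CAT0 TYPE('a)" and "v \<in> tangent_space p" and g: "\<delta> \<in> geodesics_from p"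
  shows "- tnorm v \<le> tinner p v (tvec p 1 \<delta>)"
proof -
  obtain t \<gamma> where v: "t \<ge> 0" "\<gamma> \<in> geodesics_from p" "v = tvec p t \<gamma>"
    using tangent_space_cases[OF assms(2)] .
  have "t * zeta \<gamma> * (- 1) \<le> t * zeta \<gamma> * (zeta \<delta> * cos (alexandrov_angle p \<gamma> \<delta>))"
    by (rule mult_left_mono) (use v in \<open>auto simp: zeta_def\<close>)
  then show ?thesis
    using v by (simp add: tinner_tvec[OF cat _ g] tnorm_tvec mult.assoc)
qed

text \<open>The Alexandrov angle is at most the comparison angle of the triangle \<open>p\<close>,
  \<open>x\<close>, \<open>q\<close>, whose cosine is explicit; its leg \<open>dist p x\<close>
  cancels against the length of the vector. If \<open>x = p\<close>, both sides are 0.\<close>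

lemma tinner_geod_ge:
  fixes p q x :: "'a::metric_space"
  assumes cat: "CAT0 TYPE('a)" and "t \<ge> 0" and "p \<noteq> q"
  shows "t * ((dist p x)\<^sup>2 + (dist p q)\<^sup>2 - (dist x q)\<^sup>2) / (2 * dist p q)
           \<le> tinner p (tvec p (t * dist p x) (geod p x)) (tvec p 1 (geod p q))"
proof (cases "x = p")
  case True
  then show ?thesis by (simp add: tinner_tvec[OF cat] geod_simps[OF cat])
next
  case False
  let ?c = "cos (alexandrov_angle p (geod p x) (geod p q))"
  have "cos_comparison p x q \<le> ?c"
    using cos_alexandrov_angle(2)[OF cat geod_simps(1)[OF cat, of p x] geod_simps(1)[OF cat, of p q]]
      False assms(3) by (simp add: geod_simps[OF cat])
  then have "t * dist p x * cos_comparison p x q \<le> t * dist p x * ?c"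
    using assms(2) by (intro mult_left_mono) auto
  moreover have "t * dist p x * cos_comparison p x q
      = t * ((dist p x)\<^sup>2 + (dist p q)\<^sup>2 - (dist x q)\<^sup>2) / (2 * dist p q)"
    using False by (simp add: cos_comparison_def)
  ultimately show ?thesis
    using False assms(2,3)
    by (simp add: tinner_tvec[OF cat] geod_simps[OF cat] zeta_def)
qed

subsection \<open>The resolvent\<close>

lemma resolvent_set_unique:
  fixes A :: "'a::metric_space \<Rightarrow> 'a tangent set"
  assumes cat: "CAT0 TYPE('a)" and mono: "monotone_field A" and "l > 0"
    and z: "z \<in> resolvent_set A l x" and w: "w \<in> resolvent_set A l x"
  shows "z = w"
proof (rule ccontr)
  assume ne: "z \<noteq> w"
  let ?i = "inverse l"
  have i: "?i > 0" using assms(3) by simp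
  let ?z = "tinner z (tvec z (?i * dist z x) (geod z x)) (tvec z 1 (geod z w))"
  let ?w = "tinner w (tvec w (?i * dist w x) (geod w x)) (tvec w 1 (geod w z))"
  have "?z \<le> - ?w"
    using mono z w by (auto simp: monotone_field_def resolvent_set_def)
  moreover have "?i * ((dist z x)\<^sup>2 + (dist z w)\<^sup>2 - (dist x w)\<^sup>2) / (2 * dist z w) \<le> ?z"
    using tinner_geod_ge[OF cat _ ne, of ?i] i by simp
  moreover have "?i * ((dist w x)\<^sup>2 + (dist z w)\<^sup>2 - (dist z x)\<^sup>2) / (2 * dist z w) \<le> ?w"
    using tinner_geod_ge[OF cat _ ne[symmetric], of ?i x] i by (simp add: dist_commute)
  \<comment> \<open>The distances to \<open>x\<close> cancel. The two inner products therefore have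
    a positive sum, against monotonicity.\<close>
  moreover have "?i * ((dist z x)\<^sup>2 + (dist z w)\<^sup>2 - (dist x w)\<^sup>2) / (2 * dist z w)
      + ?i * ((dist w x)\<^sup>2 + (dist z w)\<^sup>2 - (dist z x)\<^sup>2) / (2 * dist z w) = ?i * dist z w"
    using ne assms(3) by (simp add: dist_commute field_simps power2_eq_square)
  moreover have "?i * dist z w > 0" using i ne by simp
  ultimately show False by linarith
qed

text \<open>Surjectivity with \<open>t = inverse l\<close> provides a point, and uniqueness turns
  the set into a singleton, on which \<open>the_elem\<close> is meaningful.\<close>

lemma resolvent_in_resolvent_set:
  fixes A :: "'a::metric_space \<Rightarrow> 'a tangent set"
  assumes "CAT0 TYPE('a)" "monotone_field A" "surjectivity_condition A" "l > 0"
  shows "resolvent A l x \<in> resolvent_set A l x"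
proof -
  have "inverse l > 0" using assms(4) by simp
  then obtain z where z: "z \<in> resolvent_set A l x"
    using assms(3) unfolding surjectivity_condition_def resolvent_set_def by blast
  then have "resolvent_set A l x = {z}"
    using resolvent_set_unique[OF assms(1,2,4)] by blast
  then show ?thesis by (simp add: resolvent_def)
qed

section \<open>Norm bound for the Yosida approximation\<close>

theorem proposition4p9:
  fixes A :: "'a::complete_space \<Rightarrow> 'a tangent set"
    and opp :: "'a \<Rightarrow> 'a \<Rightarrow> 'a"
    and l :: real
    and x :: 'a
  assumes "CAT0 TYPE('a)"
    and "geodesic_extension TYPE('a)"
    and "opposite_choice opp"
    and "vector_field A"
    and "monotone_field A"
    and "surjectivity_condition A"
    and "l > 0"
  shows "ereal (tnorm (yosida opp A l x)) \<le> (INF v\<in>A x. ereal (tnorm v))"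
proof (rule INF_greatest)
  \<comment> \<open>One bound per element suffices: over an empty \<open>A x\<close> the infimum in
    \<open>ereal\<close> is \<infinity>.\<close>
  fix v assume v: "v \<in> A x"
  define z where "z = resolvent A l x"
  note cat = assms(1)
  have i: "inverse l > 0" using assms(7) by simp
  have tangent: "v \<in> tangent_space x" using v assms(4) by (auto simp: vector_field_def)
  \<comment> \<open>The norm is the right-hand side times \<open>zeta\<close> of the negative
    geodesic, which is at most 1.\<close>
  have "tnorm (yosida opp A l x) \<le> inverse l * dist x z"
    using i unfolding yosida_def complementary_field_def neg_geod_def z_def[symmetric]
    by (subst tnorm_tscale_tvec) (auto simp: geod_simps[OF cat] zeta_def)
  also have "\<dots> \<le> tnorm v"
  proof (cases "z = x")
    \<comment> \<open>Here the left side is 0, and writing \<open>v\<close> with a nonnegative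
      scalar shows that its norm is nonnegative.\<close>
    case True
    obtain t \<gamma> where "t \<ge> 0" "\<gamma> \<in> geodesics_from x" "v = tvec x t \<gamma>"
      using tangent_space_cases[OF tangent] .
    then show ?thesis using True by (simp add: tnorm_tvec zeta_def)
  next
    case False
    let ?w = "tvec z (inverse l * dist z x) (geod z x)"
    have "?w \<in> A z"
      using resolvent_in_resolvent_set[OF cat assms(5-7)] by (auto simp: resolvent_set_def z_def)
    then have "tinner x v (tvec x 1 (geod x z)) \<le> - tinner z ?w (tvec z 1 (geod z x))"
      using assms(5) v by (auto simp: monotone_field_def)
    moreover have "- tnorm v \<le> tinner x v (tvec x 1 (geod x z))"
      by (rule tinner_ge_minus_tnorm[OF cat tangent geod_simps(1)[OF cat]])
    \<comment> \<open>Taking \<open>q = x\<close> collapses the quotient of the lower bound to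
      \<open>dist z x\<close>.\<close>
    moreover have "inverse l * dist x z \<le> tinner z ?w (tvec z 1 (geod z x))"
      using tinner_geod_ge[OF cat less_imp_le[OF i] False, of x] False
      by (simp add: dist_commute power2_eq_square)
    ultimately show ?thesis by linarith
  qed
  finally show "ereal (tnorm (yosida opp A l x)) \<le> ereal (tnorm v)" by simp
qed

end
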